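(* Let $p$ be a prime, $q=p^s$ with $s\ge 1$, and let $\alpha$ be a primitive element of the finite field $\mathbb{F}_q$. Then the Alexander quandle $(\mathbb{F}_q,\alpha)$ is isomorphic (as a quandle) to the quandle $F_{q,\alpha}$ given by the presentation $$F_{q,\alpha}=\left\langle x,y \;\middle|\; ab^{q-1}=a,\ \ ab^k=ba^{\log_\alpha(1-\alpha^k)}\ \ \text{for } a\neq b\in\{x,y\},\ 1\le k\le q-2\right\rangle .$$
   Context: A quandle is a set $X$ with a binary operation $\triangleright$ such that (i) for all $x,y\in X$ there is a unique $z\in X$ with $y=z\triangleright x$; (ii) $(x\triangleright y)\triangleright z=(x\triangleright z)\triangleright(y\triangleright z)$ for all $x,y,z$; (iii) $x\triangleright x=x$ for all $x$. A primitive element of $\mathbb{F}_q$ is a generator of the multiplicative group $\mathbb{F}_q^*$. The Alexander quandle $(\mathbb{F}_q,\alpha)$ is the set $\mathbb{F}_q$ with operation $x\triangleright y=\alpha x+(1-\alpha)y$. For nonzero $r\in\mathbb{F}_q$, $\log_\alpha r$ is the unique integer $0\le \log_\alpha r\le q-2$ with $\alpha^{\log_\alpha r}=r$. Words are left-associated: $x_1x_2\cdots x_s$ denotes $(\cdots((x_1\triangleright x_2)\triangleright x_3)\cdots)\triangleright x_s$; in particular $ab^k$ denotes $(\cdots((a\triangleright b)\triangleright b)\cdots)\triangleright b$ with $k$ factors $b$, and $ab^0=a$. The presentation is a presentation in the category of quandles (the free quandle on $x,y$ modulo the smallest congruence generated by the relations). *)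

theory Defs
  imports "HOL-Library.Cardinality" "HOL-Computational_Algebra.Primes"
begin

record 'a quandle_struct =
  qcarrier :: "'a set"
  qop :: "'a \<Rightarrow> 'a \<Rightarrow> 'a" (infixl "\<triangleright>\<index>" 70)

locale quandle =
  fixes Q :: "'a quandle_struct" (structure)
  assumes op_closed: "\<lbrakk>x \<in> qcarrier Q; y \<in> qcarrier Q\<rbrakk> \<Longrightarrow> x \<triangleright> y \<in> qcarrier Q"
    and right_div: "\<lbrakk>x \<in> qcarrier Q; y \<in> qcarrier Q\<rbrakk> \<Longrightarrow> \<exists>!z. z \<in> qcarrier Q \<and> y = z \<triangleright> x"
    and distrib: "\<lbrakk>x \<in> qcarrier Q; y \<in> qcarrier Q; z \<in> qcarrier Q\<rbrakk>
      \<Longrightarrow> (x \<triangleright> y) \<triangleright> z = (x \<triangleright> z) \<triangleright> (y \<triangleright> z)"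
    and idem: "x \<in> qcarrier Q \<Longrightarrow> x \<triangleright> x = x"

text \<open>The second quandle operation: \<open>qinv Q y x\<close> is the unique \<open>z\<close> with \<open>y = z \<triangleright> x\<close>.\<close>

definition qinv :: "'a quandle_struct \<Rightarrow> 'a \<Rightarrow> 'a \<Rightarrow> 'a" where
  "qinv Q y x = (THE z. z \<in> qcarrier Q \<and> y = qop Q z x)"

definition qhom :: "'a quandle_struct \<Rightarrow> 'b quandle_struct \<Rightarrow> ('a \<Rightarrow> 'b) set" where
  "qhom Q R = {f. f ` qcarrier Q \<subseteq> qcarrier R \<and>
     (\<forall>x\<in>qcarrier Q. \<forall>y\<in>qcarrier Q. f (qop Q x y) = qop R (f x) (f y))}"

definition quandle_iso :: "'a quandle_struct \<Rightarrow> 'b quandle_struct \<Rightarrow> bool" (infix "\<cong>\<^sub>q" 50) where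
  "Q \<cong>\<^sub>q R \<longleftrightarrow> (\<exists>f \<in> qhom Q R. bij_betw f (qcarrier Q) (qcarrier R))"

text \<open>\<open>qword Q a b k\<close> is the left-associated word \<open>a b\<^sup>k\<close>, with \<open>k\<close> factors \<open>b\<close>.\<close>

definition qword :: "'a quandle_struct \<Rightarrow> 'a \<Rightarrow> 'a \<Rightarrow> nat \<Rightarrow> 'a" where
  "qword Q a b k = ((\<lambda>z. qop Q z b) ^^ k) a"

text \<open>On an infinite quandle, compatibility of an equivalence relation with the operation alone
  does not make the quotient satisfy the uniqueness part of the first axiom; a congruence has to
  respect the second operation too.\<close>

definition quandle_congruence :: "'a quandle_struct \<Rightarrow> ('a \<times> 'a) set \<Rightarrow> bool" where
  "quandle_congruence Q \<theta> \<longleftrightarrow> equiv (qcarrier Q) \<theta> \<and>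
     (\<forall>a a' b b'. (a, a') \<in> \<theta> \<longrightarrow> (b, b') \<in> \<theta> \<longrightarrow>
        (qop Q a b, qop Q a' b') \<in> \<theta> \<and> (qinv Q a b, qinv Q a' b') \<in> \<theta>)"

definition generated_congruence :: "'a quandle_struct \<Rightarrow> ('a \<times> 'a) set \<Rightarrow> ('a \<times> 'a) set" where
  "generated_congruence Q R = \<Inter> {\<theta>. quandle_congruence Q \<theta> \<and> R \<subseteq> \<theta>}"

definition quotient_quandle :: "'a quandle_struct \<Rightarrow> ('a \<times> 'a) set \<Rightarrow> 'a set quandle_struct" where
  "quotient_quandle Q \<theta> =
     \<lparr>qcarrier = qcarrier Q // \<theta>, qop = (\<lambda>A B. \<Union>a\<in>A. \<Union>b\<in>B. \<theta> `` {qop Q a b})\<rparr>"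

text \<open>The free quandle on the set of all elements of type \<open>'g\<close>: formal expressions in the two
  operations modulo the equational consequences of the quandle axioms. The first axiom takes the
  equational form \<open>right_op\<close>, \<open>right_inv\<close>.\<close>

datatype 'g qterm = QGen 'g | QOp "'g qterm" "'g qterm" | QInv "'g qterm" "'g qterm"

inductive qterm_eq :: "'g qterm \<Rightarrow> 'g qterm \<Rightarrow> bool" where
  refl: "qterm_eq s s"
| sym: "qterm_eq s t \<Longrightarrow> qterm_eq t s"
| trans: "qterm_eq s t \<Longrightarrow> qterm_eq t u \<Longrightarrow> qterm_eq s u"
| cong_op: "qterm_eq s s' \<Longrightarrow> qterm_eq t t' \<Longrightarrow> qterm_eq (QOp s t) (QOp s' t')"
| cong_inv: "qterm_eq s s' \<Longrightarrow> qterm_eq t t' \<Longrightarrow> qterm_eq (QInv s t) (QInv s' t')"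
| right_op: "qterm_eq (QOp (QInv s t) t) s"
| right_inv: "qterm_eq (QInv (QOp s t) t) s"
| distrib: "qterm_eq (QOp (QOp s t) u) (QOp (QOp s u) (QOp t u))"
| idem: "qterm_eq (QOp s s) s"

quotient_type 'g free_quandle_elem = "'g qterm" / qterm_eq
  by (rule equivpI) (auto intro!: reflpI sympI transpI intro: qterm_eq.intros)

lift_definition free_gen :: "'g \<Rightarrow> 'g free_quandle_elem" is QGen .

lift_definition free_op :: "'g free_quandle_elem \<Rightarrow> 'g free_quandle_elem \<Rightarrow> 'g free_quandle_elem"
  is QOp by (rule qterm_eq.cong_op)

lift_definition free_inv :: "'g free_quandle_elem \<Rightarrow> 'g free_quandle_elem \<Rightarrow> 'g free_quandle_elem"
  is QInv by (rule qterm_eq.cong_inv)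

definition free_quandle :: "'g free_quandle_elem quandle_struct" where
  "free_quandle = \<lparr>qcarrier = UNIV, qop = free_op\<rparr>"

definition presented_quandle ::
    "('g free_quandle_elem \<times> 'g free_quandle_elem) set \<Rightarrow> 'g free_quandle_elem set quandle_struct" where
  "presented_quandle R = quotient_quandle free_quandle (generated_congruence free_quandle R)"

definition alexander_quandle :: "'a::field \<Rightarrow> 'a quandle_struct" where
  "alexander_quandle \<alpha> = \<lparr>qcarrier = UNIV, qop = (\<lambda>x y. \<alpha> * x + (1 - \<alpha>) * y)\<rparr>"

definition primitive_element :: "'a::{field,finite} \<Rightarrow> bool" where
  "primitive_element \<alpha> \<longleftrightarrow> range (\<lambda>n::int. \<alpha> powi n) = UNIV - {0}"

definition disc_log :: "'a::{field,finite} \<Rightarrow> 'a \<Rightarrow> nat" where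
  "disc_log \<alpha> r = (THE l. l \<le> CARD('a) - 2 \<and> \<alpha> ^ l = r)"

datatype xy = Gx | Gy

definition F_relations :: "'a::{field,finite} \<Rightarrow> (xy free_quandle_elem \<times> xy free_quandle_elem) set" where
  "F_relations \<alpha> =
     {(qword free_quandle a b (CARD('a) - 1), a) | a b.
        a \<in> {free_gen Gx, free_gen Gy} \<and> b \<in> {free_gen Gx, free_gen Gy} \<and> a \<noteq> b} \<union>
     {(qword free_quandle a b k, qword free_quandle b a (disc_log \<alpha> (1 - \<alpha> ^ k))) | a b k.
        a \<in> {free_gen Gx, free_gen Gy} \<and> b \<in> {free_gen Gx, free_gen Gy} \<and> a \<noteq> b \<and>
        1 \<le> k \<and> k \<le> CARD('a) - 2}"

definition F_quandle :: "'a::{field,finite} \<Rightarrow> xy free_quandle_elem set quandle_struct" where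
  "F_quandle \<alpha> = presented_quandle (F_relations \<alpha>)"

lemma free_op_inv [simp]: "free_op (free_inv s t) t = s"
  by transfer (rule qterm_eq.right_op)

lemma free_inv_op [simp]: "free_inv (free_op s t) t = s"
  by transfer (rule qterm_eq.right_inv)

lemma quandle_free_quandle: "quandle free_quandle"
proof
  fix x y z :: "'g free_quandle_elem"
  show "\<exists>!z. z \<in> qcarrier free_quandle \<and> y = qop free_quandle z x"
    by (rule ex1I[of _ "free_inv y x"]) (auto simp: free_quandle_def)
  show "qop free_quandle (qop free_quandle x y) z =
        qop free_quandle (qop free_quandle x z) (qop free_quandle y z)"
    unfolding free_quandle_def quandle_struct.simps by transfer (rule qterm_eq.distrib)
  show "qop free_quandle x x = x"
    unfolding free_quandle_def quandle_struct.simps by transfer (rule qterm_eq.idem)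
qed (simp add: free_quandle_def)

context quandle
begin

lemma qinv: 
  assumes "x \<in> qcarrier Q" "y \<in> qcarrier Q"
  shows qinv_closed: "qinv Q y x \<in> qcarrier Q" and op_qinv: "qinv Q y x \<triangleright> x = y"
  using theI'[OF right_div[OF assms]] unfolding qinv_def by auto

lemma qinv_op: "x \<in> qcarrier Q \<Longrightarrow> y \<in> qcarrier Q \<Longrightarrow> qinv Q (y \<triangleright> x) x = y"
  by (metis op_closed op_qinv qinv_closed right_div)

primrec eval :: "('g \<Rightarrow> 'a) \<Rightarrow> 'g qterm \<Rightarrow> 'a" where
  "eval f (QGen g) = f g"
| "eval f (QOp s t) = eval f s \<triangleright> eval f t"
| "eval f (QInv s t) = qinv Q (eval f s) (eval f t)"

lemma eval_closed: "(\<And>g. f g \<in> qcarrier Q) \<Longrightarrow> eval f t \<in> qcarrier Q"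
  by (induction t) (auto simp: op_closed qinv_closed)

lemma eval_cong:
  assumes "qterm_eq s t" "\<And>g. f g \<in> qcarrier Q"
  shows "eval f s = eval f t"
proof -
  note c = eval_closed[of f, OF assms(2)]
  show ?thesis
    using assms(1)
  proof (induction rule: qterm_eq.induct)
    case (distrib s t u)
    show ?case unfolding eval.simps by (rule quandle.distrib[OF quandle_axioms c c c])
  qed (simp_all add: op_qinv qinv_op idem c)
qed

end

lemma free_quandle_universal:
  assumes "quandle Q" and f: "\<And>g. f g \<in> qcarrier Q"
  shows "\<exists>!h. h \<in> qhom free_quandle Q \<and> (\<forall>g. h (free_gen g) = f g)"
proof -
  interpret quandle Q by fact
  define h where "h a = eval f (rep_free_quandle_elem a)" for a
  have h_abs: "h (abs_free_quandle_elem t) = eval f t" for t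
    unfolding h_def
    by (rule eval_cong[OF _ f]) (rule Quotient3_rep_abs[OF Quotient3_free_quandle_elem], rule qterm_eq.refl)
  have hop: "h (free_op a b) = qop Q (h a) (h b)" for a b
  proof -
    obtain s t where st: "a = abs_free_quandle_elem s" "b = abs_free_quandle_elem t"
      by (metis Quotient3_abs_rep[OF Quotient3_free_quandle_elem])
    show ?thesis by (simp add: st free_op.abs_eq h_abs)
  qed
  show ?thesis
  proof (rule ex1I[of _ h])
    show "h \<in> qhom free_quandle Q \<and> (\<forall>g. h (free_gen g) = f g)"
      using eval_closed[OF f] hop
      by (auto simp: qhom_def free_quandle_def free_gen.abs_eq h_abs) (auto simp: h_def)
  next
    fix h' assume h': "h' \<in> qhom free_quandle Q \<and> (\<forall>g. h' (free_gen g) = f g)"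
    then have c: "h' a \<in> qcarrier Q" and o: "h' (free_op a b) = qop Q (h' a) (h' b)" for a b
      by (auto simp: qhom_def free_quandle_def)
    have i: "h' (free_inv a b) = qinv Q (h' a) (h' b)" for a b
      by (metis c o qinv_op free_op_inv)
    have "h' (abs_free_quandle_elem t) = eval f t" for t
      by (induction t) 
        (use h' in \<open>auto simp: o i simp flip: free_gen.abs_eq free_op.abs_eq free_inv.abs_eq\<close>)
    then show "h' = h"
      by (metis ext h_abs Quotient3_abs_rep[OF Quotient3_free_quandle_elem])
  qed
qed

lemma quandle_congruence_generated:
  assumes "quandle Q" "R \<subseteq> qcarrier Q \<times> qcarrier Q"
  shows "quandle_congruence Q (generated_congruence Q R)"
proof -
  interpret quandle Q by fact
  have "quandle_congruence Q (qcarrier Q \<times> qcarrier Q)"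
    by (auto simp: quandle_congruence_def op_closed qinv_closed equiv_def refl_on_def sym_on_def trans_on_def)
  then have "generated_congruence Q R \<subseteq> qcarrier Q \<times> qcarrier Q"
    using assms(2) unfolding generated_congruence_def by blast
  moreover have "equiv (qcarrier Q) (generated_congruence Q R)"
  proof (rule equivI)
    show "refl_on (qcarrier Q) (generated_congruence Q R)"
      by (auto simp: generated_congruence_def quandle_congruence_def equiv_def refl_on_def)
    show "sym (generated_congruence Q R)"
      by (auto simp: generated_congruence_def quandle_congruence_def equiv_def intro!: symI dest: symD)
    show "trans (generated_congruence Q R)"
      by (rule transI) (auto simp: generated_congruence_def quandle_congruence_def equiv_def dest: transD)
  qed (use calculation in auto)
  ultimately show ?thesis
    by (auto simp: generated_congruence_def quandle_congruence_def)
qed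

lemma quandle_quotient_quandle:
  assumes "quandle Q" and \<theta>: "quandle_congruence Q \<theta>"
  shows "quandle (quotient_quandle Q \<theta>)"
proof -
  interpret quandle Q by fact
  let ?C = "\<lambda>a. \<theta> `` {a}"
  have eq: "equiv (qcarrier Q) \<theta>"
    and c: "\<And>a a' b b'. (a, a') \<in> \<theta> \<Longrightarrow> (b, b') \<in> \<theta> \<Longrightarrow> (qop Q a b, qop Q a' b') \<in> \<theta>"
    and ci: "\<And>a a' b b'. (a, a') \<in> \<theta> \<Longrightarrow> (b, b') \<in> \<theta> \<Longrightarrow> (qinv Q a b, qinv Q a' b') \<in> \<theta>"
    using \<theta> by (auto simp: quandle_congruence_def)
  have op: "qop (quotient_quandle Q \<theta>) (?C a) (?C b) = ?C (qop Q a b)"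
    if "a \<in> qcarrier Q" "b \<in> qcarrier Q" for a b
    using UN_equiv_class2[OF eq eq _ that, of "\<lambda>a b. ?C (qop Q a b)"]
    by (auto simp: quotient_quandle_def congruent2_def intro!: equiv_class_eq[OF eq] c)
  have car: "A \<in> qcarrier (quotient_quandle Q \<theta>) \<longleftrightarrow> (\<exists>a\<in>qcarrier Q. A = ?C a)" for A
    by (auto simp: quotient_quandle_def quotient_def)
  have eqC: "?C a = ?C b \<longleftrightarrow> (a, b) \<in> \<theta>" if "a \<in> qcarrier Q" "b \<in> qcarrier Q" for a b
    using eq that by (metis eq_equiv_class equiv_class_eq)
  show ?thesis
  proof
    fix A B D assume "A \<in> qcarrier (quotient_quandle Q \<theta>)" "B \<in> qcarrier (quotient_quandle Q \<theta>)"
    then obtain a b where ab: "a \<in> qcarrier Q" "A = ?C a" "b \<in> qcarrier Q" "B = ?C b"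
      by (auto simp: car)
    then show "qop (quotient_quandle Q \<theta>) A B \<in> qcarrier (quotient_quandle Q \<theta>)"
      by (auto simp: op car op_closed)
    show "\<exists>!Z. Z \<in> qcarrier (quotient_quandle Q \<theta>) \<and> B = qop (quotient_quandle Q \<theta>) Z A"
    proof (rule ex1I[of _ "?C (qinv Q b a)"])
      show "?C (qinv Q b a) \<in> qcarrier (quotient_quandle Q \<theta>) \<and>
            B = qop (quotient_quandle Q \<theta>) (?C (qinv Q b a)) A"
        using ab by (auto simp: car op qinv_closed op_qinv)
    next
      fix Z assume Z: "Z \<in> qcarrier (quotient_quandle Q \<theta>) \<and> B = qop (quotient_quandle Q \<theta>) Z A"
      then obtain z where z: "z \<in> qcarrier Q" "Z = ?C z" by (auto simp: car)
      have "(b, qop Q z a) \<in> \<theta>" using Z ab z by (simp add: op eqC op_closed)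
      moreover have "(a, a) \<in> \<theta>" using eq ab by (auto simp: equiv_def refl_on_def)
      ultimately have "(qinv Q b a, z) \<in> \<theta>" using ci qinv_op ab z by metis
      then have "?C (qinv Q b a) = ?C z" by (rule equiv_class_eq[OF eq])
      then show "Z = ?C (qinv Q b a)" using z by simp
    qed
    assume "D \<in> qcarrier (quotient_quandle Q \<theta>)"
    then obtain d where "d \<in> qcarrier Q" "D = ?C d" by (auto simp: car)
    then show "qop (quotient_quandle Q \<theta>) (qop (quotient_quandle Q \<theta>) A B) D =
        qop (quotient_quandle Q \<theta>) (qop (quotient_quandle Q \<theta>) A D) (qop (quotient_quandle Q \<theta>) B D)"
      using ab distrib[of a b d] by (simp add: op op_closed)
  next
    fix A assume "A \<in> qcarrier (quotient_quandle Q \<theta>)"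
    then show "qop (quotient_quandle Q \<theta>) A A = A" by (auto simp: car op idem)
  qed
qed

lemma quandle_presented_quandle: "quandle (presented_quandle R)"
  unfolding presented_quandle_def
  by (intro quandle_quotient_quandle quandle_congruence_generated quandle_free_quandle)
    (auto simp: free_quandle_def)

lemma quandle_alexander_quandle:
  assumes "\<alpha> \<noteq> 0"
  shows "quandle (alexander_quandle \<alpha>)"
proof
  fix x y z :: 'a
  show "\<exists>!z. z \<in> qcarrier (alexander_quandle \<alpha>) \<and> y = qop (alexander_quandle \<alpha>) z x"
    by (rule ex1I[of _ "(y - (1 - \<alpha>) * x) / \<alpha>"]) (use assms in \<open>auto simp: alexander_quandle_def\<close>)
qed (auto simp: alexander_quandle_def algebra_simps)

end

theory Submission
  imports Defs
begin

text \<open>Sending \<open>x\<close> to \<open>0\<close> and \<open>y\<close> to \<open>1\<close> respects the relations, because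
  \<open>a b\<^sup>k = \<alpha>\<^sup>k a + (1 - \<alpha>\<^sup>k) b\<close> in the Alexander quandle. Hence the \<open>q\<close> words \<open>x\<close> and \<open>y x\<^sup>k\<close>
  (\<open>0 \<le> k \<le> q - 2\<close>), which are sent to \<open>0\<close> and \<open>\<alpha>\<^sup>k\<close>, are distinct in the presented quandle.
  The set \<open>S\<close> of these words is invariant under right translation by \<open>x\<close>; the relations say that
  exchanging \<open>x\<close> and \<open>y\<close> does not change \<open>S\<close>, so it is invariant under translation by \<open>y\<close> too.
  The translation by \<open>a \<triangleright> b\<close> is a conjugate of the translation by \<open>a\<close>, so the elements whose
  translation preserves \<open>S\<close> form a subquandle; it contains the generators and is therefore
  everything. Thus \<open>S\<close> is the whole presented quandle.\<close>

section \<open>Homomorphisms, kernels and quotients\<close>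

lemma qword_0 [simp]: "qword Q a b 0 = a"
  and qword_Suc [simp]: "qword Q a b (Suc k) = qop Q (qword Q a b k) b"
  by (simp_all add: qword_def)

lemma qword_add: "qword Q a b (m + n) = qword Q (qword Q a b m) b n"
  by (induction n) auto

lemma (in quandle) qword_closed:
  "a \<in> qcarrier Q \<Longrightarrow> b \<in> qcarrier Q \<Longrightarrow> qword Q a b k \<in> qcarrier Q"
  by (induction k) (auto simp: op_closed)

lemma qhom_qword:
  assumes "quandle Q" "h \<in> qhom Q R" "a \<in> qcarrier Q" "b \<in> qcarrier Q"
  shows "h (qword Q a b k) = qword R (h a) (h b) k"
  using assms quandle.qword_closed[of Q a b] by (induction k) (auto simp: qhom_def)

text \<open>Uniqueness of right division in \<open>R\<close>: the image of \<open>qinv Q a b\<close>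
  solves the equation that characterizes the right-hand side.\<close>

lemma qhom_qinv:
  assumes "quandle Q" "quandle R" "h \<in> qhom Q R" "a \<in> qcarrier Q" "b \<in> qcarrier Q"
  shows "h (qinv Q a b) = qinv R (h a) (h b)"
proof -
  interpret Q: quandle Q by fact
  interpret R: quandle R by fact
  have "h a = qop R (h (qinv Q a b)) (h b)" and "h b \<in> qcarrier R" and "h (qinv Q a b) \<in> qcarrier R"
    using assms Q.op_qinv[of b a] Q.qinv_closed[of b a] by (force simp: qhom_def)+
  then show ?thesis
    by (simp add: R.qinv_op)
qed

lemma quandle_congruence_kernel:
  assumes "quandle Q" "quandle R" "h \<in> qhom Q R"
  shows "quandle_congruence Q {(a, b). a \<in> qcarrier Q \<and> b \<in> qcarrier Q \<and> h a = h b}"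
proof -
  interpret quandle Q by fact
  have "equiv (qcarrier Q) {(a, b). a \<in> qcarrier Q \<and> b \<in> qcarrier Q \<and> h a = h b}"
    by (auto simp: equiv_def refl_on_def intro!: symI transI)
  moreover have "h (qop Q a b) = qop R (h a) (h b)" if "a \<in> qcarrier Q" "b \<in> qcarrier Q" for a b
    using assms that by (auto simp: qhom_def)
  ultimately show ?thesis
    using qhom_qinv[OF assms] by (auto simp: quandle_congruence_def op_closed qinv_closed)
qed

lemma generated_congruence_superset: "R \<subseteq> generated_congruence Q R"
  by (auto simp: generated_congruence_def)

text \<open>The kernel of \<open>h\<close> is a congruence containing \<open>R\<close>, hence one of
  the relations intersected in \<open>generated_congruence\<close>. This lets values in a target
  quandle separate elements of a presented one.\<close>

lemma generated_congruence_qhom: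
  assumes "quandle Q" "quandle P" "h \<in> qhom Q P" "R \<subseteq> qcarrier Q \<times> qcarrier Q"
    and "\<And>a b. (a, b) \<in> R \<Longrightarrow> h a = h b"
    and "(a, b) \<in> generated_congruence Q R"
  shows "h a = h b"
proof -
  have "R \<subseteq> {(a, b). a \<in> qcarrier Q \<and> b \<in> qcarrier Q \<and> h a = h b}"
    using assms by auto
  then show ?thesis
    using quandle_congruence_kernel[OF assms(1-3)] assms(6) unfolding generated_congruence_def by blast
qed

lemma qop_quotient_quandle:
  assumes "quandle_congruence Q \<theta>" "a \<in> qcarrier Q" "b \<in> qcarrier Q"
  shows "qop (quotient_quandle Q \<theta>) (\<theta> `` {a}) (\<theta> `` {b}) = \<theta> `` {qop Q a b}"
proof -
  have eq: "equiv (qcarrier Q) \<theta>"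
    and c: "\<And>a a' b b'. (a, a') \<in> \<theta> \<Longrightarrow> (b, b') \<in> \<theta> \<Longrightarrow> (qop Q a b, qop Q a' b') \<in> \<theta>"
    using assms(1) by (auto simp: quandle_congruence_def)
  show ?thesis
    using UN_equiv_class2[OF eq eq _ assms(2,3), of "\<lambda>a b. \<theta> `` {qop Q a b}"]
    by (auto simp: quotient_quandle_def congruent2_def intro!: equiv_class_eq[OF eq] c)
qed

section \<open>Generation in the free quandle\<close>

lemma qcarrier_free_quandle [simp]: "qcarrier free_quandle = UNIV"
  and qop_free_quandle [simp]: "qop free_quandle = free_op"
  by (simp_all add: free_quandle_def)

lemma qinv_free_quandle [simp]: "qinv free_quandle a b = free_inv a b"
  using quandle.qinv_op[OF quandle_free_quandle, of b "free_inv a b"] by simp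

lemma free_distrib: "free_op (free_op a b) c = free_op (free_op a c) (free_op b c)"
  by transfer (rule qterm_eq.distrib)

lemma free_idem [simp]: "free_op a a = a"
  by transfer (rule qterm_eq.idem)

lemma free_quandle_induct [case_names gen op inv]:
  assumes "\<And>g. P (free_gen g)"
    and "\<And>a b. P a \<Longrightarrow> P b \<Longrightarrow> P (free_op a b)"
    and "\<And>a b. P a \<Longrightarrow> P b \<Longrightarrow> P (free_inv a b)"
  shows "P a"
proof -
  have "P (abs_free_quandle_elem t)" for t
    by (induction t)
      (use assms in \<open>auto simp flip: free_gen.abs_eq free_op.abs_eq free_inv.abs_eq\<close>)
  then show ?thesis
    by (metis Quotient3_abs_rep[OF Quotient3_free_quandle_elem])
qed

text \<open>The elements whose translation preserves \<open>S\<close> in both directions contain the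
  generators and are closed under both operations. Once every translation preserves
  \<open>S\<close>, the set \<open>S\<close> is closed under both operations as well.\<close>

lemma free_quandle_translation_invariant:
  assumes gen: "\<And>g. free_gen g \<in> S"
    and inv: "\<And>g a. free_op a (free_gen g) \<in> S \<longleftrightarrow> a \<in> S"
  shows "z \<in> S"
proof -
  have T: "free_op a z \<in> S \<longleftrightarrow> a \<in> S" for a z
  proof (induction z arbitrary: a rule: free_quandle_induct)
    case (gen g)
    show ?case by (rule inv)
  next
    case (op u v)
    \<comment> \<open>Since \<open>a\<close> is \<open>free_inv a v\<close> translated by
      \<open>v\<close>, distributivity pulls the translation by \<open>v\<close> outside.\<close>
    have "free_op a (free_op u v) = free_op (free_op (free_inv a v) u) v"
      by (simp add: free_distrib[of _ u v])
    then show ?case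
      using op.IH(1)[of "free_inv a v"] op.IH(2)[of "free_inv a v"] op.IH(2) by simp
  next
    case (inv u v)
    \<comment> \<open>Moving \<open>v\<close> past the translation by \<open>free_inv u v\<close>
      turns it into the translation by \<open>u\<close>.\<close>
    have "free_op (free_op a (free_inv u v)) v = free_op (free_op a v) u"
      by (simp add: free_distrib[of _ _ v])
    then show ?case
      using inv.IH by metis
  qed
  show ?thesis
  proof (induction z rule: free_quandle_induct)
    \<comment> \<open>Translating \<open>free_inv u v\<close> by \<open>v\<close> gives
      \<open>u\<close>, which lies in \<open>S\<close>.\<close>
    case (inv u v)
    then show ?case using T[of "free_inv u v" v] by simp
  qed (use gen T in auto)
qed

section \<open>Powers of a primitive element\<close>

text \<open>Multiplication by \<open>a\<close> permutes the nonzero elements, so it leaves their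
  nonzero product unchanged while multiplying it by \<open>a ^ (CARD('a) - 1)\<close>.\<close>

lemma finite_field_power_card_minus_1:
  fixes a :: "'a::{field,finite}"
  assumes "a \<noteq> 0"
  shows "a ^ (CARD('a) - 1) = 1"
proof -
  let ?U = "UNIV - {0::'a}"
  have "bij_betw ((*) a) ?U ?U"
    by (rule bij_betw_byWitness[where f' = "\<lambda>x. x / a"]) (use assms in auto)
  then have "(\<Prod>x\<in>?U. a * x) = \<Prod>?U"
    by (rule prod.reindex_bij_betw)
  moreover have "\<Prod>?U \<noteq> 0"
    by simp
  ultimately show ?thesis
    by (simp add: prod.distrib card_Diff_singleton)
qed

lemma card_field_ge_2: "2 \<le> CARD('a::{field,finite})"
  using card_mono[of UNIV "{0, 1 :: 'a}"] by simp

lemma primitive_element_nonzero: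
  assumes "primitive_element \<alpha>"
  shows "\<alpha> \<noteq> 0"
  using assms rangeI[of "\<lambda>n. \<alpha> powi n" 1] by (auto simp: primitive_element_def)

text \<open>Integer exponents reduce modulo \<open>CARD('a) - 1\<close>, so the powers with smaller
  natural exponents exhaust the nonzero elements; counting then gives injectivity.\<close>

lemma primitive_element_bij_betw:
  fixes \<alpha> :: "'a::{field,finite}"
  assumes "primitive_element \<alpha>"
  shows "bij_betw (\<lambda>k. \<alpha> ^ k) {..<CARD('a) - 1} (UNIV - {0})"
proof -
  let ?n = "CARD('a) - 1"
  have \<alpha>: "\<alpha> \<noteq> 0" by (rule primitive_element_nonzero) fact
  have n: "?n > 0" using card_field_ge_2[where 'a='a] by simp
  have "\<alpha> powi k = \<alpha> ^ nat (k mod int ?n)" for k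
  proof -
    have "\<alpha> powi k = \<alpha> powi (int ?n * (k div int ?n) + k mod int ?n)"
      by simp
    also have "\<dots> = (\<alpha> ^ ?n) powi (k div int ?n) * \<alpha> powi (k mod int ?n)"
      by (simp only: power_int_add[OF disjI1[OF \<alpha>]] power_int_mult power_int_of_nat)
    also have "\<dots> = \<alpha> ^ nat (k mod int ?n)"
      unfolding finite_field_power_card_minus_1[OF \<alpha>] using n by (simp add: power_int_def)
    finally show ?thesis .
  qed
  moreover have "nat (k mod int ?n) < ?n" for k
    using n by (simp add: nat_less_iff)
  ultimately have "range (\<lambda>k::int. \<alpha> powi k) \<subseteq> (\<lambda>k. \<alpha> ^ k) ` {..<?n}"
    by (metis image_subsetI imageI lessThan_iff)
  then have "UNIV - {0} \<subseteq> (\<lambda>k. \<alpha> ^ k) ` {..<?n}"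
    using assms by (simp add: primitive_element_def)
  then have im: "(\<lambda>k. \<alpha> ^ k) ` {..<?n} = UNIV - {0}"
    using \<alpha> by auto
  moreover have "inj_on (\<lambda>k. \<alpha> ^ k) {..<?n}"
    by (rule eq_card_imp_inj_on, simp, unfold im, simp add: card_Diff_singleton)
  ultimately show ?thesis
    by (simp add: bij_betw_def)
qed

lemma disc_log_power:
  fixes \<alpha> :: "'a::{field,finite}"
  assumes "primitive_element \<alpha>" "k < CARD('a) - 1"
  shows "disc_log \<alpha> (\<alpha> ^ k) = k"
  unfolding disc_log_def
proof (rule the_equality)
  fix l assume "l \<le> CARD('a) - 2 \<and> \<alpha> ^ l = \<alpha> ^ k"
  then show "l = k"
    using assms(2) bij_betw_imp_inj_on[OF primitive_element_bij_betw[OF assms(1)]]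
    by (auto simp: inj_on_def)
qed (use assms in auto)

lemma power_disc_log:
  fixes \<alpha> :: "'a::{field,finite}"
  assumes "primitive_element \<alpha>" "r \<noteq> 0"
  shows "\<alpha> ^ disc_log \<alpha> r = r"
proof -
  obtain k where "k < CARD('a) - 1" "r = \<alpha> ^ k"
    using bij_betw_imp_surj_on[OF primitive_element_bij_betw[OF assms(1)]] assms(2) by auto
  then show ?thesis
    by (simp add: disc_log_power[OF assms(1)])
qed

lemma qword_alexander_quandle: "qword (alexander_quandle \<alpha>) a b k = \<alpha> ^ k * a + (1 - \<alpha> ^ k) * b"
proof (induction k)
  case (Suc k)
  then show ?case
    by (simp only: qword_Suc) (simp add: alexander_quandle_def algebra_simps)
qed simp

section \<open>Words in the presented quandle\<close>

text \<open>The relations in a form symmetric in \<open>x\<close> and \<open>y\<close>, so that each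
  lemma can be reused with the generators exchanged. In the application \<open>n\<close> is q - 1
  and \<open>l\<close> gives the logarithms.\<close>

locale two_generator_relations =
  fixes \<theta> :: "('g free_quandle_elem \<times> 'g free_quandle_elem) set" and n :: nat
    and l :: "nat \<Rightarrow> nat" and x y :: "'g free_quandle_elem"
  assumes congruence: "quandle_congruence free_quandle \<theta>"
    and n_pos: "n > 0"
    and power_xy: "(qword free_quandle x y n, x) \<in> \<theta>"
    and power_yx: "(qword free_quandle y x n, y) \<in> \<theta>"
    and swap_xy: "\<And>k. 0 < k \<Longrightarrow> k < n \<Longrightarrow> (qword free_quandle x y k, qword free_quandle y x (l k)) \<in> \<theta>"
    and swap_yx: "\<And>k. 0 < k \<Longrightarrow> k < n \<Longrightarrow> (qword free_quandle y x k, qword free_quandle x y (l k)) \<in> \<theta>"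
begin

lemma commuted: "two_generator_relations \<theta> n l y x"
  by unfold_locales (fact congruence n_pos power_xy power_yx swap_xy swap_yx)+

lemma \<theta>_refl: "(a, a) \<in> \<theta>"
  and \<theta>_sym: "(a, b) \<in> \<theta> \<Longrightarrow> (b, a) \<in> \<theta>"
  and \<theta>_trans: "(a, b) \<in> \<theta> \<Longrightarrow> (b, c) \<in> \<theta> \<Longrightarrow> (a, c) \<in> \<theta>"
  using congruence unfolding quandle_congruence_def equiv_def
  by (auto simp: refl_on_def dest: symD transD)

text \<open>A congruence respects the second operation, which cancels \<open>c\<close>.\<close>

lemma \<theta>_op_iff: "(free_op a c, free_op b c) \<in> \<theta> \<longleftrightarrow> (a, b) \<in> \<theta>"
  using congruence \<theta>_refl[of c] unfolding quandle_congruence_def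
  by (metis free_inv_op qinv_free_quandle qop_free_quandle)

lemma \<theta>_qword: "(a, b) \<in> \<theta> \<Longrightarrow> (qword free_quandle a c k, qword free_quandle b c k) \<in> \<theta>"
  by (induction k) (auto simp: \<theta>_op_iff)

lemma qword_mod: "(qword free_quandle y x k, qword free_quandle y x (k mod n)) \<in> \<theta>"
proof (induction k rule: less_induct)
  case (less k)
  show ?case
  proof (cases "k < n")
    case True
    then show ?thesis by (simp add: \<theta>_refl)
  next
    case False
    then have "qword free_quandle y x k = qword free_quandle (qword free_quandle y x n) x (k - n)"
      by (simp flip: qword_add)
    then have "(qword free_quandle y x k, qword free_quandle y x (k - n)) \<in> \<theta>"
      using \<theta>_qword[OF power_yx] by simp
    moreover have "(qword free_quandle y x (k - n), qword free_quandle y x (k mod n)) \<in> \<theta>"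
      using less[of "k - n"] False n_pos by (simp add: le_mod_geq)
    ultimately show ?thesis by (rule \<theta>_trans)
  qed
qed

definition word_elems :: "'g free_quandle_elem set" where
  "word_elems = {a. (a, x) \<in> \<theta> \<or> (\<exists>k. (a, qword free_quandle y x k) \<in> \<theta>)}"

lemma word_elems_op: "free_op a x \<in> word_elems \<longleftrightarrow> a \<in> word_elems"
proof
  assume "a \<in> word_elems"
  then consider "(a, x) \<in> \<theta>" | k where "(a, qword free_quandle y x k) \<in> \<theta>"
    by (auto simp: word_elems_def)
  then show "free_op a x \<in> word_elems"
  proof cases
    case 1
    then show ?thesis
      using \<theta>_op_iff[of a x x] by (simp add: word_elems_def)
  next
    case 2
    then have "(free_op a x, qword free_quandle y x (Suc k)) \<in> \<theta>"
      by (simp add: \<theta>_op_iff)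
    then show ?thesis
      unfolding word_elems_def by blast
  qed
next
  assume "free_op a x \<in> word_elems"
  then consider "(free_op a x, x) \<in> \<theta>" | k where "(free_op a x, qword free_quandle y x k) \<in> \<theta>"
    by (auto simp: word_elems_def)
  then show "a \<in> word_elems"
  proof cases
    case 1
    then show ?thesis
      using \<theta>_op_iff[of a x x] by (simp add: word_elems_def)
  next
    case (2 k)
    \<comment> \<open>Cancelling a factor \<open>x\<close> requires a positive exponent, so exponent
      0 is replaced by \<open>n\<close>.\<close>
    obtain j where j: "(free_op a x, qword free_quandle y x (Suc j)) \<in> \<theta>"
    proof (cases k)
      case 0
      with 2 have "(free_op a x, qword free_quandle y x n) \<in> \<theta>"
        using \<theta>_sym[OF power_yx] by (auto intro: \<theta>_trans)
      with that[of "n - 1"] n_pos show ?thesis by simp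
    qed (use 2 that in blast)
    then show ?thesis
      by (auto simp: \<theta>_op_iff word_elems_def)
  qed
qed

lemma word_elems_subset_commuted:
  "word_elems \<subseteq> two_generator_relations.word_elems \<theta> y x"
proof
  interpret C: two_generator_relations \<theta> n l y x by (rule commuted)
  fix a assume "a \<in> word_elems"
  then consider "(a, x) \<in> \<theta>" | k where "(a, qword free_quandle y x k) \<in> \<theta>"
    by (auto simp: word_elems_def)
  then show "a \<in> C.word_elems"
  proof cases
    case 1
    then have "(a, qword free_quandle x y 0) \<in> \<theta>" by simp
    then show ?thesis unfolding C.word_elems_def by blast
  next
    case (2 k)
    have k: "(a, qword free_quandle y x (k mod n)) \<in> \<theta>"
      using 2 qword_mod by (rule \<theta>_trans)
    show ?thesis
    \<comment> \<open>The swap relations start at exponent 1. Exponent 0 leaves \<open>y\<close>,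
      which is the separately listed generator in \<open>C.word_elems\<close>.\<close>
    proof (cases "k mod n = 0")
      case True
      with k show ?thesis by (simp add: C.word_elems_def)
    next
      case False
      then have "(a, qword free_quandle x y (l (k mod n))) \<in> \<theta>"
        using swap_yx[of "k mod n"] k n_pos by (auto intro: \<theta>_trans)
      then show ?thesis unfolding C.word_elems_def by blast
    qed
  qed
qed

lemma word_elems_UNIV:
  assumes "range free_gen = {x, y}"
  shows "word_elems = UNIV"
proof -
  interpret C: two_generator_relations \<theta> n l y x by (rule commuted)
  have eq: "word_elems = C.word_elems"
    using word_elems_subset_commuted C.word_elems_subset_commuted by blast
  have x: "x \<in> word_elems" and y: "y \<in> C.word_elems"
    unfolding word_elems_def C.word_elems_def using \<theta>_refl by blast+
  have gen: "free_gen g \<in> {x, y}" for g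
    using assms by blast
  have "z \<in> word_elems" for z
  proof (rule free_quandle_translation_invariant)
    show "free_gen g \<in> word_elems" for g
      using gen[of g] x y eq by auto
    show "free_op a (free_gen g) \<in> word_elems \<longleftrightarrow> a \<in> word_elems" for g a
      using gen[of g] word_elems_op[of a] C.word_elems_op[of a] eq by auto
  qed
  then show ?thesis by blast
qed

end

section \<open>The isomorphism\<close>

text \<open>The powers with exponents \<open>k\<close> and 0 have different logarithms, so
  \<open>\<alpha> ^ k\<close> is not 1 and the logarithm is taken of a nonzero element.\<close>

lemma disc_log_relation:
  fixes \<alpha> :: "'a::{field,finite}"
  assumes "primitive_element \<alpha>" "1 \<le> k" "k \<le> CARD('a) - 2"
  shows "\<alpha> ^ disc_log \<alpha> (1 - \<alpha> ^ k) = 1 - \<alpha> ^ k"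
proof (rule power_disc_log[OF assms(1)])
  have "disc_log \<alpha> (\<alpha> ^ k) = k" "disc_log \<alpha> (\<alpha> ^ 0) = 0"
    using assms by (auto intro!: disc_log_power simp del: power_0)
  then show "1 - \<alpha> ^ k \<noteq> 0"
    using assms(2) by auto
qed

theorem theorem3p4:
  fixes p s :: nat and \<alpha> :: "'a::{field,finite}"
  assumes "prime p" and "s \<ge> 1" and "CARD('a) = p ^ s"
    and "primitive_element \<alpha>"
  shows "alexander_quandle \<alpha> \<cong>\<^sub>q F_quandle \<alpha>"
proof -
  let ?A = "alexander_quandle \<alpha>" and ?x = "free_gen Gx" and ?y = "free_gen Gy"
  let ?F = "free_quandle :: xy free_quandle_elem quandle_struct"
  note prim = assms(4)
  have \<alpha>: "\<alpha> \<noteq> 0" by (rule primitive_element_nonzero) fact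
  note A = quandle_alexander_quandle[OF \<alpha>]
  have carrier_A: "qcarrier ?A = UNIV"
    by (simp add: alexander_quandle_def)
  define \<theta> where "\<theta> = generated_congruence ?F (F_relations \<alpha>)"
  have R\<theta>: "F_relations \<alpha> \<subseteq> \<theta>"
    unfolding \<theta>_def by (rule generated_congruence_superset)
  have cong: "quandle_congruence ?F \<theta>"
    unfolding \<theta>_def by (rule quandle_congruence_generated[OF quandle_free_quandle]) simp
  then have equiv: "equiv UNIV \<theta>"
    by (simp add: quandle_congruence_def)

  obtain h where h: "h \<in> qhom ?F ?A" and hg: "\<And>g. h (free_gen g) = (case g of Gx \<Rightarrow> 0 | Gy \<Rightarrow> 1)"
    using free_quandle_universal[OF A, of "\<lambda>g. case g of Gx \<Rightarrow> 0 | Gy \<Rightarrow> 1"] carrier_A by blast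
  have h_word: "h (qword ?F a b k) = \<alpha> ^ k * h a + (1 - \<alpha> ^ k) * h b" for a b k
    using qhom_qword[OF quandle_free_quandle h] by (simp add: qword_alexander_quandle)
  have h_op: "h (free_op a b) = qop ?A (h a) (h b)" for a b
    using h by (auto simp: qhom_def)
  have xy: "?x \<noteq> ?y"
    using hg[of Gx] hg[of Gy] by auto
  \<comment> \<open>Both sides of a swap relation evaluate to \<open>\<alpha> ^ k\<close> if its
    word starts with \<open>a = ?y\<close>, and to \<open>1 - \<alpha> ^ k\<close> if it starts with
    \<open>a = ?x\<close>.\<close>
  have h_rel: "h a = h b" if "(a, b) \<in> F_relations \<alpha>" for a b
    using that disc_log_relation[OF prim]
    by (auto simp: F_relations_def h_word hg finite_field_power_card_minus_1[OF \<alpha>, simplified])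
  have h_\<theta>: "h a = h b" if "(a, b) \<in> \<theta>" for a b
    using generated_congruence_qhom[OF quandle_free_quandle A h _ h_rel] that by (simp add: \<theta>_def)

  have power_rel: "(qword ?F a b (CARD('a) - 1), a) \<in> \<theta>"
    if "a \<in> {?x, ?y}" "b \<in> {?x, ?y}" "a \<noteq> b" for a b
    using that R\<theta> unfolding F_relations_def by blast
  have swap_rel: "(qword ?F a b k, qword ?F b a (disc_log \<alpha> (1 - \<alpha> ^ k))) \<in> \<theta>"
    if "a \<in> {?x, ?y}" "b \<in> {?x, ?y}" "a \<noteq> b" "0 < k" "k < CARD('a) - 1" for a b k
  proof -
    have "1 \<le> k" "k \<le> CARD('a) - 2"
      using that by auto
    then show ?thesis
      using that R\<theta> unfolding F_relations_def by blast
  qed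
  interpret two_generator_relations \<theta> "CARD('a) - 1" "\<lambda>k. disc_log \<alpha> (1 - \<alpha> ^ k)" ?x ?y
  proof
    show "quandle_congruence ?F \<theta>" by (fact cong)
    show "CARD('a) - 1 > 0"
      using card_field_ge_2[where 'a='a] by simp
  qed (use xy in \<open>auto intro!: power_rel swap_rel simp del: One_nat_def\<close>)
  have gens: "range free_gen = {?x, ?y}"
    by (auto simp: image_iff) (metis xy.exhaust)

  \<comment> \<open>A right inverse of \<open>h\<close> by words; 0 has no logarithm and is
    represented by \<open>?x\<close>.\<close>
  define w where "w c = (if c = 0 then ?x else qword ?F ?y ?x (disc_log \<alpha> c))" for c
  have hw: "h (w c) = c" for c
    by (simp add: w_def h_word hg power_disc_log[OF prim])
  \<comment> \<open>Some \<open>w c\<close> is congruent to \<open>a\<close> because the words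
    exhaust the quotient; applying \<open>h\<close> identifies \<open>c\<close> as
    \<open>h a\<close>.\<close>
  have w_onto: "(a, w (h a)) \<in> \<theta>" for a
  proof -
    have "\<exists>c. (a, w c) \<in> \<theta>"
    proof -
      consider "(a, ?x) \<in> \<theta>" | k where "(a, qword ?F ?y ?x k) \<in> \<theta>"
        using word_elems_UNIV[OF gens] by (auto simp: word_elems_def)
      then show ?thesis
      proof cases
        case 1
        then have "(a, w 0) \<in> \<theta>" by (simp add: w_def)
        then show ?thesis ..
      next
        case (2 k)
        \<comment> \<open>The exponent is reduced first, so that \<open>disc_log\<close> returns
          exactly this exponent.\<close>
        have "w (\<alpha> ^ (k mod (CARD('a) - 1))) = qword ?F ?y ?x (k mod (CARD('a) - 1))"
          using \<alpha> n_pos by (simp add: w_def disc_log_power[OF prim])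
        then show ?thesis
          using \<theta>_trans[OF 2 qword_mod] by metis
      qed
    qed
    then show ?thesis
      using h_\<theta> hw by metis
  qed

  let ?P = "quotient_quandle ?F \<theta>"
  have class_eq: "\<theta> `` {a} = \<theta> `` {b}" if "(a, b) \<in> \<theta>" for a b
    using equiv_class_eq[OF equiv that] .
  have class_op: "qop ?P (\<theta> `` {a}) (\<theta> `` {b}) = \<theta> `` {free_op a b}" for a b
    using qop_quotient_quandle[OF cong, of a b] by simp
  have carrier_P: "qcarrier ?P = UNIV // \<theta>"
    by (simp add: quotient_quandle_def)
  have "(\<lambda>c. \<theta> `` {w c}) \<in> qhom ?A ?P"
  proof -
    \<comment> \<open>The product of the words \<open>w c\<close> and \<open>w d\<close> is
      congruent to the word of its own image under \<open>h\<close>, and that image is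
      \<open>qop ?A c d\<close>.\<close>
    have "\<theta> `` {w (qop ?A c d)} = qop ?P (\<theta> `` {w c}) (\<theta> `` {w d})" for c d
      using class_eq[OF w_onto[of "free_op (w c) (w d)"]] by (simp add: class_op h_op hw)
    then show ?thesis
      by (auto simp: qhom_def carrier_P quotientI)
  qed
  moreover have "bij_betw (\<lambda>c. \<theta> `` {w c}) (qcarrier ?A) (qcarrier ?P)"
    unfolding bij_betw_def carrier_A carrier_P
  proof
    show "inj (\<lambda>c. \<theta> `` {w c})"
    proof (rule injI)
      fix c d assume "\<theta> `` {w c} = \<theta> `` {w d}"
      then have "(w c, w d) \<in> \<theta>"
        using eq_equiv_class[OF _ equiv] by blast
      then show "c = d"
        using h_\<theta> hw by metis
    qed
    show "range (\<lambda>c. \<theta> `` {w c}) = UNIV // \<theta>"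
    proof
      show "UNIV // \<theta> \<subseteq> range (\<lambda>c. \<theta> `` {w c})"
        using class_eq[OF w_onto] by (auto elim!: quotientE)
    qed (auto intro: quotientI)
  qed
  ultimately show ?thesis
    unfolding quandle_iso_def F_quandle_def presented_quandle_def \<theta>_def[symmetric] by blast
qed

end
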